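(* Let $A$ be a finite dimensional Leibniz algebra over a field $\mathbb{F}$. If $B$ and $C$ are nilpotent ideals of $A$, then $B + C$ is a nilpotent ideal of $A$.
   Context: A Leibniz algebra over a field $\mathbb{F}$ is an $\mathbb{F}$-vector space $A$ with a bilinear product satisfying $x(yz) = (xy)z + y(xz)$ for all $x,y,z \in A$ (a left Leibniz algebra). An ideal of $A$ is a two-sided ideal, i.e. a subspace $I$ with $AI \subseteq I$ and $IA \subseteq I$. An ideal is nilpotent if it is nilpotent as an algebra, where an algebra $N$ is nilpotent if there is $k \ge 1$ such that every product of $k$ elements of $N$, with any arrangement of parentheses, is $0$. *)

theory Defs
  imports Complex_Main
begin

text \<open>The algebra is the whole type \<open>'a\<close>, as for the locale \<^locale>\<open>vector_space\<close>.\<close>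

locale leibniz_algebra = vector_space scale
  for scale :: "'f::field \<Rightarrow> 'a::ab_group_add \<Rightarrow> 'a" (infixr "*s" 75) +
  fixes mult :: "'a \<Rightarrow> 'a \<Rightarrow> 'a" (infixl "\<cdot>" 70)
  assumes linear_left: "Vector_Spaces.linear (*s) (*s) (\<lambda>x. x \<cdot> y)"
    and linear_right: "Vector_Spaces.linear (*s) (*s) (\<lambda>y. x \<cdot> y)"
    and leibniz: "x \<cdot> (y \<cdot> z) = (x \<cdot> y) \<cdot> z + y \<cdot> (x \<cdot> z)"
begin

definition ideal :: "'a set \<Rightarrow> bool" where
  "ideal I \<longleftrightarrow> subspace I \<and> (\<forall>a. \<forall>x\<in>I. a \<cdot> x \<in> I \<and> x \<cdot> a \<in> I)"

text \<open>\<open>product_of N k x\<close>: \<open>x\<close> is a product of \<open>k\<close> elements of \<open>N\<close> with some arrangement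
  of parentheses.\<close>

inductive product_of :: "'a set \<Rightarrow> nat \<Rightarrow> 'a \<Rightarrow> bool" for N where
  single: "x \<in> N \<Longrightarrow> product_of N 1 x"
| mult: "product_of N i x \<Longrightarrow> product_of N j y \<Longrightarrow> product_of N (i + j) (x \<cdot> y)"

definition nilpotent :: "'a set \<Rightarrow> bool" where
  "nilpotent N \<longleftrightarrow> (\<exists>k\<ge>1. \<forall>x. product_of N k x \<longrightarrow> x = 0)"

definition nilpotent_ideal :: "'a set \<Rightarrow> bool" where
  "nilpotent_ideal I \<longleftrightarrow> ideal I \<and> nilpotent I"

end

end

theory Submission
  imports Defs
begin

text \<open>The powers \<open>I\<^sup>n\<close> of an ideal \<open>I\<close>, with \<open>I\<^sup>0\<close> the whole algebra and \<open>I\<^sup>n\<close> spanned by the products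
  of \<open>n\<close> elements of \<open>I\<close>, form a multiplicative filtration: \<open>I\<^sup>i I\<^sup>j \<subseteq> I\<^sup>i\<^sup>+\<^sup>j\<close>. The cases \<open>i = 0\<close> and
  \<open>j = 0\<close>, which say that each \<open>I\<^sup>n\<close> is an ideal, are where the Leibniz identity enters
  (\<open>ideal_power_mult\<close>); they also make the filtration decreasing (\<open>ideal_power_antimono\<close>).

  For two ideals the intersections \<open>B\<^sup>i \<inter> C\<^sup>j\<close> are therefore multiplicative in both indices at once.
  A summand of an element of \<open>B + C\<close> lies in \<open>B\<^sup>1 \<inter> C\<^sup>0\<close> or in \<open>B\<^sup>0 \<inter> C\<^sup>1\<close>, so a product of \<open>n\<close>
  elements of \<open>B + C\<close> is a sum of elements of intersections \<open>B\<^sup>i \<inter> C\<^sup>j\<close> with \<open>i + j = n\<close>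
  (\<open>product_of_sum\<close>). If \<open>B\<^sup>p = 0\<close>, \<open>C\<^sup>q = 0\<close> and \<open>n = p + q\<close>, then \<open>i \<ge> p\<close> or \<open>j \<ge> q\<close>, so all these
  intersections vanish.\<close>

context leibniz_algebra
begin

lemma mult_add_left: "(x + y) \<cdot> z = x \<cdot> z + y \<cdot> z"
  using linear_left[of z] by (simp add: Vector_Spaces.linear_iff)

lemma mult_add_right: "x \<cdot> (y + z) = x \<cdot> y + x \<cdot> z"
  using linear_right[of x] by (simp add: Vector_Spaces.linear_iff)

lemma mult_scale_left: "(c *s x) \<cdot> z = c *s (x \<cdot> z)"
  using linear_left[of z] by (simp add: Vector_Spaces.linear_iff)

lemma mult_scale_right: "x \<cdot> (c *s z) = c *s (x \<cdot> z)"
  using linear_right[of x] by (simp add: Vector_Spaces.linear_iff)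

lemma mult_zero_left: "0 \<cdot> z = 0"
  using mult_scale_left[of 0 0 z] by simp

lemma mult_zero_right: "x \<cdot> 0 = 0"
  using mult_scale_right[of x 0 0] by simp

lemma leibniz_left: "(x \<cdot> y) \<cdot> z = x \<cdot> (y \<cdot> z) - y \<cdot> (x \<cdot> z)"
  using leibniz[of x y z] by simp

lemma subspace_mult_left_vimage: "subspace U \<Longrightarrow> subspace {x. x \<cdot> y \<in> U}"
  by (simp add: subspace_def mult_zero_left mult_add_left mult_scale_left)

lemma subspace_mult_right_vimage: "subspace U \<Longrightarrow> subspace {y. x \<cdot> y \<in> U}"
  by (simp add: subspace_def mult_zero_right mult_add_right mult_scale_right)

lemma mult_span_subset:
  assumes "x \<in> span S" "y \<in> span T" and U: "subspace U"
    and gen: "\<And>s t. s \<in> S \<Longrightarrow> t \<in> T \<Longrightarrow> s \<cdot> t \<in> U"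
  shows "x \<cdot> y \<in> U"
proof -
  have "s \<cdot> y \<in> U" if "s \<in> S" for s
    using span_minimal[OF _ subspace_mult_right_vimage[OF U, of s], of T] gen[OF that] assms(2)
    by blast
  then show ?thesis
    using span_minimal[OF _ subspace_mult_left_vimage[OF U, of y], of S] assms(1) by blast
qed

text \<open>The value at \<open>0\<close> is the whole algebra, so that absorption by an ideal is the case of exponent
  \<open>0\<close> of multiplicativity.\<close>

definition ideal_power :: "'a set \<Rightarrow> nat \<Rightarrow> 'a set" where
  "ideal_power I n = (if n = 0 then UNIV else span {x. product_of I n x})"

lemma subspace_ideal_power: "subspace (ideal_power I n)"
  by (simp add: ideal_power_def)

lemma ideal_power_0: "ideal_power I 0 = UNIV"
  by (simp add: ideal_power_def)

lemma product_of_pos: "product_of N n x \<Longrightarrow> n > 0"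
  by (induction rule: product_of.induct) auto

lemma product_of_ideal_power: "product_of I n x \<Longrightarrow> x \<in> ideal_power I n"
  by (simp add: ideal_power_def span_base)

lemma ideal_power_mult_pos:
  assumes "i > 0" "j > 0" "x \<in> ideal_power I i" "y \<in> ideal_power I j"
  shows "x \<cdot> y \<in> ideal_power I (i + j)"
proof (rule mult_span_subset[OF _ _ subspace_ideal_power])
  show "x \<in> span {x. product_of I i x}" "y \<in> span {x. product_of I j x}"
    using assms by (auto simp: ideal_power_def)
qed (simp add: product_of_ideal_power product_of.mult)

text \<open>Left multiplication by \<open>a\<close> is a derivation that maps \<open>I\<close> into itself, so it maps a product of
  elements of \<open>I\<close> to a sum of products with the same number of factors.\<close>

lemma ideal_mult_product_of:
  assumes "ideal I" "product_of I n x"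
  shows "a \<cdot> x \<in> ideal_power I n"
  using assms(2)
proof (induction rule: product_of.induct)
  case (single x)
  then show ?case
    using assms(1) by (auto simp: ideal_def intro!: product_of_ideal_power product_of.single[simplified])
next
  case (mult i x j y)
  have "(a \<cdot> x) \<cdot> y \<in> ideal_power I (i + j)" "x \<cdot> (a \<cdot> y) \<in> ideal_power I (i + j)"
    using mult by (blast intro: ideal_power_mult_pos product_of_pos product_of_ideal_power)+
  then show ?case
    by (simp add: leibniz[of a] subspace_add[OF subspace_ideal_power])
qed

text \<open>Right multiplication is not a derivation, but \<open>(x y) a = x (y a) - y (x a)\<close> moves \<open>a\<close> into a
  factor and keeps the number of factors from \<open>I\<close>.\<close>

lemma product_of_mult_ideal:
  assumes "ideal I" "product_of I n x"
  shows "x \<cdot> a \<in> ideal_power I n"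
  using assms(2)
proof (induction rule: product_of.induct)
  case (single x)
  then show ?case
    using assms(1) by (auto simp: ideal_def intro!: product_of_ideal_power product_of.single[simplified])
next
  case (mult i x j y)
  have "x \<cdot> (y \<cdot> a) \<in> ideal_power I (i + j)"
    using mult by (blast intro: ideal_power_mult_pos product_of_pos product_of_ideal_power)+
  moreover have "y \<cdot> (x \<cdot> a) \<in> ideal_power I (j + i)"
    using mult by (blast intro: ideal_power_mult_pos product_of_pos product_of_ideal_power)
  ultimately show ?case
    by (simp add: leibniz_left[of x y] subspace_diff[OF subspace_ideal_power] add.commute)
qed

lemma ideal_power_mult:
  assumes I: "ideal I" and x: "x \<in> ideal_power I i" and y: "y \<in> ideal_power I j"
  shows "x \<cdot> y \<in> ideal_power I (i + j)"
proof -
  consider "i = 0" "j = 0" | "i = 0" "j > 0" | "i > 0" "j = 0" | "i > 0" "j > 0"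
    by blast
  then show ?thesis
  proof cases
    case 1
    then show ?thesis by (simp add: ideal_power_0)
  next
    case 2
    show ?thesis
    proof (rule mult_span_subset[OF _ _ subspace_ideal_power])
      show "x \<in> span UNIV" "y \<in> span {y. product_of I j y}"
        using 2 y by (auto simp: ideal_power_def)
    qed (use 2 I in \<open>simp add: ideal_mult_product_of\<close>)
  next
    case 3
    show ?thesis
    proof (rule mult_span_subset[OF _ _ subspace_ideal_power])
      show "x \<in> span {x. product_of I i x}" "y \<in> span UNIV"
        using 3 x by (auto simp: ideal_power_def)
    qed (use 3 I in \<open>simp add: product_of_mult_ideal\<close>)
  next
    case 4
    then show ?thesis using ideal_power_mult_pos x y by blast
  qed
qed

text \<open>Some of the factors of a product of elements of \<open>I\<close> may be regarded as arbitrary elements of the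
  algebra, which gives a product with fewer factors from \<open>I\<close>.\<close>

lemma product_of_ideal_power_le:
  assumes "ideal I" "product_of I n x" "m \<le> n"
  shows "x \<in> ideal_power I m"
  using assms(2,3)
proof (induction arbitrary: m rule: product_of.induct)
  case (single x)
  then show ?case
    by (cases m) (auto simp: ideal_power_0 intro!: product_of_ideal_power product_of.single[simplified])
next
  case (mult i x j y)
  have "x \<cdot> y \<in> ideal_power I (min m i + (m - i))"
    using mult by (intro ideal_power_mult[OF assms(1)]) auto
  then show ?case
    by (simp add: min_def split: if_splits)
qed

lemma ideal_power_antimono:
  assumes "ideal I" "m \<le> n"
  shows "ideal_power I n \<subseteq> ideal_power I m"
proof (cases "n = 0")
  case False
  then have "ideal_power I n = span {x. product_of I n x}"
    by (simp add: ideal_power_def)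
  also have "\<dots> \<subseteq> ideal_power I m"
    using assms by (intro span_minimal subspace_ideal_power) (auto intro: product_of_ideal_power_le)
  finally show ?thesis .
qed (use assms in simp)

lemma nilpotent_ideal_power:
  assumes "nilpotent I"
  shows "\<exists>k. ideal_power I k = {0}"
proof -
  obtain k where k: "k \<ge> 1" "\<And>x. product_of I k x \<Longrightarrow> x = 0"
    using assms by (auto simp: nilpotent_def)
  have "span {x. product_of I k x} \<subseteq> {0}"
    using k by (intro span_minimal) auto
  then have "ideal_power I k = {0}"
    using k(1) span_zero by (auto simp: ideal_power_def)
  then show ?thesis ..
qed

lemma product_of_sum:
  assumes B: "ideal B" and C: "ideal C"
    and "product_of {b + c |b c. b \<in> B \<and> c \<in> C} n x"
  shows "x \<in> span (\<Union>i\<le>n. ideal_power B i \<inter> ideal_power C (n - i))"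
  using assms(3)
proof (induction rule: product_of.induct)
  case (single x)
  then obtain b c where x: "x = b + c" "b \<in> B" "c \<in> C"
    by blast
  have "b \<in> ideal_power B 1 \<inter> ideal_power C (1 - 1)" "c \<in> ideal_power B 0 \<inter> ideal_power C (1 - 0)"
    using x by (simp_all only: Int_iff diff_zero diff_self_eq_0 ideal_power_0 UNIV_I
        product_of_ideal_power product_of.single)
  then show ?case
    unfolding x(1) by (intro span_add span_base) blast+
next
  case (mult m x n y)
  show ?case
  proof (rule mult_span_subset[OF mult.IH subspace_span])
    fix s t
    assume "s \<in> (\<Union>i\<le>m. ideal_power B i \<inter> ideal_power C (m - i))"
      and "t \<in> (\<Union>j\<le>n. ideal_power B j \<inter> ideal_power C (n - j))"
    then obtain i j where ij: "i \<le> m" "j \<le> n"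
      and "s \<in> ideal_power B i" "t \<in> ideal_power B j"
      and "s \<in> ideal_power C (m - i)" "t \<in> ideal_power C (n - j)"
      by blast
    then have "s \<cdot> t \<in> ideal_power B (i + j)" "s \<cdot> t \<in> ideal_power C ((m - i) + (n - j))"
      using ideal_power_mult B C by blast+
    moreover have "(m - i) + (n - j) = m + n - (i + j)"
      using ij by simp
    ultimately have "s \<cdot> t \<in> ideal_power B (i + j) \<inter> ideal_power C (m + n - (i + j))"
      by simp
    then show "s \<cdot> t \<in> span (\<Union>i\<le>m + n. ideal_power B i \<inter> ideal_power C (m + n - i))"
      using ij by (intro span_base UN_I[of "i + j"]) auto
  qed
qed

lemma ideal_sum:
  assumes "ideal B" "ideal C"
  shows "ideal {b + c |b c. b \<in> B \<and> c \<in> C}"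
  unfolding ideal_def
proof (intro conjI allI ballI)
  show "subspace {b + c |b c. b \<in> B \<and> c \<in> C}"
    using assms subspace_sums[of B C] by (simp add: ideal_def)
next
  fix a x
  assume "x \<in> {b + c |b c. b \<in> B \<and> c \<in> C}"
  then obtain b c where "x = b + c" "b \<in> B" "c \<in> C"
    by blast
  moreover from this have "a \<cdot> b \<in> B" "a \<cdot> c \<in> C" "b \<cdot> a \<in> B" "c \<cdot> a \<in> C"
    using assms by (simp_all add: ideal_def)
  ultimately show "a \<cdot> x \<in> {b + c |b c. b \<in> B \<and> c \<in> C}" "x \<cdot> a \<in> {b + c |b c. b \<in> B \<and> c \<in> C}"
    using mult_add_left mult_add_right by blast+
qed

lemma nilpotent_sum:
  assumes "ideal B" "ideal C" "nilpotent B" "nilpotent C"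
  shows "nilpotent {b + c |b c. b \<in> B \<and> c \<in> C}"
proof -
  obtain p q where p: "ideal_power B p = {0}" and q: "ideal_power C q = {0}"
    using assms nilpotent_ideal_power by meson
  \<comment> \<open>The successor only ensures a positive number of factors.\<close>
  let ?n = "Suc (p + q)"
  have "ideal_power B i \<inter> ideal_power C (?n - i) \<subseteq> {0}" for i
  proof (cases "p \<le> i")
    case True
    then show ?thesis
      using ideal_power_antimono[OF assms(1) True] p by blast
  next
    case False
    then have "q \<le> ?n - i" by simp
    then show ?thesis
      using ideal_power_antimono[OF assms(2), of q] q by blast
  qed
  then have "span (\<Union>i\<le>?n. ideal_power B i \<inter> ideal_power C (?n - i)) \<subseteq> {0}"
    by (intro span_minimal) auto
  then have "x = 0" if "product_of {b + c |b c. b \<in> B \<and> c \<in> C} ?n x" for x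
    using product_of_sum[OF assms(1,2) that] by blast
  then show ?thesis
    unfolding nilpotent_def by (intro exI[of _ ?n]) auto
qed

end

theorem mainTheorem4:
  fixes scale :: "'f::field \<Rightarrow> 'a::ab_group_add \<Rightarrow> 'a"
    and mult :: "'a \<Rightarrow> 'a \<Rightarrow> 'a"
    and B C :: "'a set"
  assumes "leibniz_algebra scale mult"
    and "\<exists>Basis. finite_dimensional_vector_space scale Basis"
    and "leibniz_algebra.nilpotent_ideal scale mult B"
    and "leibniz_algebra.nilpotent_ideal scale mult C"
  shows "leibniz_algebra.nilpotent_ideal scale mult {b + c |b c. b \<in> B \<and> c \<in> C}"
proof -
  interpret leibniz_algebra scale mult
    by (rule assms(1))
  show ?thesis
    using assms(3,4) ideal_sum nilpotent_sum unfolding nilpotent_ideal_def by blast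
qed

end
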